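(* Let $t$ be a positive even integer and let $M$ be a matroid. Let $\sigma=(e_1, e_2, \ldots, e_n)$ be an even $t$-cyclic ordering of $E(M)$, and suppose that $\Phi=(P_1, P_2, \ldots, P_m)$ is a concatenation of $\sigma$ such that, for all $i\in [m]$, if $$P_i=\{e_{j+1}, e_{j+2}, \ldots, e_{j+k}\},$$ then $|P_i|\ge t-2$, $|P_i|$ is even, and $j+1$ is odd. Then $\Phi$ is a $(t-1)$-flower. Moreover, for all $i\in [m]$, we have $\sqcap(P_i, P_{i+1})=\frac{1}{2}(t-2)$.
   Context: Notation: $[n]=\{1,\ldots,n\}$. For a cyclic ordering $(e_1,\ldots,e_n)$ of $E(M)$, subscripts of elements are interpreted modulo $n$; subscripts of petals $P_1,\ldots,P_m$ are interpreted modulo $m$. $t$-cyclic orderings: Let $M$ be a matroid with $n=|E(M)|$ and let $t$ be a positive integer with $n\ge t+1$. A cyclic ordering $\sigma=(e_1,\ldots,e_n)$ of $E(M)$ is an even $t$-cyclic ordering of $M$ if, for all odd $i\in[n]$, the set $\{e_i,e_{i+1},\ldots,e_{i+t-1}\}$ is both a $t$-element circuit and a $t$-element cocircuit. Concatenation: $(P_1,\ldots,P_m)$ is a concatenation of $\sigma$ if there are indices $1\le k_1<k_2<\cdots<k_m\le n$ such that, for each $i\in[m]$, $P_i$ consists of the elements $e_{k_{i-1}},e_{k_{i-1}+1},\ldots,e_{k_i-1}$ read cyclically in $\sigma$, where $k_0=k_m$; that is, the $P_i$ are non-empty sets of consecutive elements that partition $E(M)$ and occur in this cyclic order (for $m=1$,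 $P_1=E(M)$). In the expression $P_i=\{e_{j+1},\ldots,e_{j+k}\}$, the elements are listed in the order of $\sigma$, with $e_{j+1}$ the first element of the block $P_i$ and $k=|P_i|$. Connectivity: for $X\subseteq E(M)$, $\lambda(X)=r(X)+r(E(M)-X)-r(M)$. The set $X$ is exactly $k$-separating if $\lambda(X)=k-1$. For $X,Y\subseteq E(M)$, $\sqcap(X,Y)=r(X)+r(Y)-r(X\cup Y)$. Flowers: For an integer $m>1$, a partition $\Phi=(P_1,\ldots,P_m)$ of $E(M)$ into non-empty sets (petals) is a $k$-flower if each $P_i$ is exactly $k$-separating and, when $m\ge 3$, each $P_i\cup P_{i+1}$ is exactly $k$-separating. By convention $(E(M))$ is a $k$-flower with a single petal.
   Formalization: The "moreover" claim on ⊓(P_i,P_{i+1}) is stated only for m ≥ 3: for m = 2 the petals are complementary, so ⊓ = t−2, and for m = 1 it is r(M) ≥ t−1, so the claim fails there (except m = t = 2, where it follows from the flower part). *)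

theory Defs
  imports Complex_Main "HOL-Library.Disjoint_Sets"
begin

record 'a matroid_struct =
  ground :: "'a set"
  indep :: "'a set \<Rightarrow> bool"

locale matroid =
  fixes M :: "'a matroid_struct"
  assumes finite_ground: "finite (ground M)"
    and indep_subset_ground: "indep M X \<Longrightarrow> X \<subseteq> ground M"
    and indep_empty: "indep M {}"
    and indep_mono: "indep M Y \<Longrightarrow> X \<subseteq> Y \<Longrightarrow> indep M X"
    and indep_augment:
      "indep M X \<Longrightarrow> indep M Y \<Longrightarrow> card X < card Y \<Longrightarrow> \<exists>y\<in>Y - X. indep M (insert y X)"

definition basis :: "'a matroid_struct \<Rightarrow> 'a set \<Rightarrow> bool" where
  "basis M B \<longleftrightarrow> indep M B \<and> (\<forall>X. indep M X \<and> B \<subseteq> X \<longrightarrow> X = B)"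

definition circuit :: "'a matroid_struct \<Rightarrow> 'a set \<Rightarrow> bool" where
  "circuit M C \<longleftrightarrow> C \<subseteq> ground M \<and> \<not> indep M C \<and> (\<forall>D. D \<subset> C \<longrightarrow> indep M D)"

definition dual :: "'a matroid_struct \<Rightarrow> 'a matroid_struct" where
  "dual M = \<lparr> ground = ground M,
              indep = (\<lambda>X. X \<subseteq> ground M \<and> (\<exists>B. basis M B \<and> B \<inter> X = {})) \<rparr>"

definition cocircuit :: "'a matroid_struct \<Rightarrow> 'a set \<Rightarrow> bool" where
  "cocircuit M C \<longleftrightarrow> circuit (dual M) C"

definition rank :: "'a matroid_struct \<Rightarrow> 'a set \<Rightarrow> nat" where
  "rank M X = Max (card ` {I. I \<subseteq> X \<and> indep M I})"

definition connectivity :: "'a matroid_struct \<Rightarrow> 'a set \<Rightarrow> int" where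
  "connectivity M X =
     int (rank M X) + int (rank M (ground M - X)) - int (rank M (ground M))"

definition local_connectivity :: "'a matroid_struct \<Rightarrow> 'a set \<Rightarrow> 'a set \<Rightarrow> int" where
  "local_connectivity M X Y = int (rank M X) + int (rank M Y) - int (rank M (X \<union> Y))"

definition exactly_separating :: "'a matroid_struct \<Rightarrow> nat \<Rightarrow> 'a set \<Rightarrow> bool" where
  "exactly_separating M k X \<longleftrightarrow> connectivity M X = int k - 1"

text \<open>
  Cyclic sequences are lists whose entries are numbered from 1, with subscripts read modulo
  the length: \<open>cyc [x\<^sub>1, \<dots>, x\<^sub>n] i\<close> is \<open>x\<^sub>i\<close>, and in particular subscript 0 denotes \<open>x\<^sub>n\<close>.
\<close>

definition cyc :: "'b list \<Rightarrow> nat \<Rightarrow> 'b" where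
  "cyc xs i = xs ! ((i + length xs - 1) mod length xs)"

definition even_cyclic_ordering :: "nat \<Rightarrow> 'a matroid_struct \<Rightarrow> 'a list \<Rightarrow> bool" where
  "even_cyclic_ordering t M \<sigma> \<longleftrightarrow>
     0 < t \<and> t + 1 \<le> length \<sigma> \<and> distinct \<sigma> \<and> set \<sigma> = ground M \<and>
     (\<forall>i\<in>{1..length \<sigma>}. odd i \<longrightarrow>
        (let S = cyc \<sigma> ` {i..i + t - 1} in card S = t \<and> circuit M S \<and> cocircuit M S))"

text \<open>
  The elements with subscripts \<open>a, a + 1, \<dots>, b - 1\<close>, read cyclically. The case \<open>a = b\<close> is
  the full cycle starting at \<open>a\<close>, not the empty set: it occurs for concatenations with a
  single block.
\<close>

definition cyclic_block :: "'a list \<Rightarrow> nat \<Rightarrow> nat \<Rightarrow> 'a set" where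
  "cyclic_block \<sigma> a b = cyc \<sigma> ` {a..<(if a < b then b else b + length \<sigma>)}"

text \<open>
  \<open>\<Phi> = (P\<^sub>1, \<dots>, P\<^sub>m)\<close> is the concatenation of \<open>\<sigma>\<close> given by the indices
  \<open>\<kappa> = (k\<^sub>1, \<dots>, k\<^sub>m)\<close>. The first element of the block \<open>P\<^sub>i\<close> has subscript \<open>cyc \<kappa> (i - 1)\<close>;
  for \<open>i = 1\<close> this is \<open>k\<^sub>0 = k\<^sub>m\<close>.
\<close>

definition concatenation :: "'a list \<Rightarrow> nat list \<Rightarrow> 'a set list \<Rightarrow> bool" where
  "concatenation \<sigma> \<kappa> \<Phi> \<longleftrightarrow>
     1 \<le> length \<Phi> \<and> length \<kappa> = length \<Phi> \<and>
     set \<kappa> \<subseteq> {1..length \<sigma>} \<and> sorted_wrt (<) \<kappa> \<and>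
     (\<forall>i\<in>{1..length \<Phi>}. cyc \<Phi> i = cyclic_block \<sigma> (cyc \<kappa> (i - 1)) (cyc \<kappa> i))"

definition flower :: "'a matroid_struct \<Rightarrow> nat \<Rightarrow> 'a set list \<Rightarrow> bool" where
  "flower M k \<Phi> \<longleftrightarrow>
     \<Phi> = [ground M] \<or>
     (1 < length \<Phi> \<and> distinct \<Phi> \<and> partition_on (ground M) (set \<Phi>) \<and>
      (\<forall>i\<in>{1..length \<Phi>}. exactly_separating M k (cyc \<Phi> i)) \<and>
      (3 \<le> length \<Phi> \<longrightarrow>
        (\<forall>i\<in>{1..length \<Phi>}. exactly_separating M k (cyc \<Phi> i \<union> cyc \<Phi> (i + 1)))))"

end

theory Submission imports Defs begin

text \<open>
  Write \<open>t = 2 * s\<close> and \<open>n = 2 * N\<close>, where \<open>n\<close> is even because the blocks partition the ground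
  set into sets of even size. Call a set of consecutive elements starting at an odd subscript
  and consisting of \<open>k\<close> pairs a run. The whole theorem follows from the fact that the rank of
  a run depends only on its length: it is \<open>s - 1 + k\<close> whenever both the run and its complement
  contain at least \<open>s - 1\<close> pairs (\<open>rank_run\<close>). Indeed \<open>s - 1\<close> pairs lie properly inside a
  circuit and are independent, and each further pair raises the rank by exactly one: its second
  element closes a circuit with the pairs before it, whereas its first element begins a
  cocircuit avoiding the run and so is not spanned by it. Moreover \<open>M\<close> has rank \<open>N\<close>
  (\<open>rank_ground\<close>), because removing a cocircuit leaves a hyperplane that is itself a run.

  The complement of a run of \<open>k\<close> pairs is a run of \<open>N - k\<close> pairs, so the connectivity is
  \<open>(s - 1 + k) + (s - 1 + N - k) - N = 2 * (s - 1) = t - 2\<close>, and for two adjacent runs of \<open>k\<close>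
  and \<open>l\<close> pairs the local connectivity is
  \<open>(s - 1 + k) + (s - 1 + l) - (s - 1 + k + l) = s - 1\<close>.
  A single block is a flower by convention. If there are at least two, the blocks, and the unions
  of two cyclically adjacent blocks when there are at least three, are such runs: the required
  \<open>s - 1\<close> pairs outside them are supplied by the next block.
\<close>

section \<open>Rank, circuits and cocircuits\<close>

context matroid
begin

lemma finite_indep_subsets: "finite {I. I \<subseteq> X \<and> indep M I}"
  by (rule finite_subset[OF _ finite_Pow_iff[THEN iffD2, OF finite_ground]])
     (auto dest: indep_subset_ground)

lemma finite_indep: "indep M I \<Longrightarrow> finite I"
  using finite_ground finite_subset indep_subset_ground by metis

lemma card_le_rank:
  assumes "indep M I" and "I \<subseteq> X"
  shows "card I \<le> rank M X"
  unfolding rank_def using assms finite_indep_subsets by (intro Max_ge) auto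

lemma rank_witness:
  obtains I where "I \<subseteq> X" and "indep M I" and "card I = rank M X"
proof -
  have "{I. I \<subseteq> X \<and> indep M I} \<noteq> {}"
    using indep_empty by auto
  then have "rank M X \<in> card ` {I. I \<subseteq> X \<and> indep M I}"
    unfolding rank_def using finite_indep_subsets by (intro Max_in) auto
  then show ?thesis using that by auto
qed

lemma rank_mono:
  assumes "X \<subseteq> Y"
  shows "rank M X \<le> rank M Y"
proof -
  obtain I where "I \<subseteq> X" "indep M I" "card I = rank M X"
    by (rule rank_witness)
  then show ?thesis using card_le_rank[of I Y] assms by auto
qed

lemma rank_le_card:
  assumes "finite X"
  shows "rank M X \<le> card X"
  using rank_witness[of X] card_mono[OF assms] by metis

lemma rank_indep: "indep M I \<Longrightarrow> rank M I = card I"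
  using card_le_rank[of I I] rank_le_card[OF finite_indep, of I] by simp

lemma rank_insert_le: "rank M (insert x X) \<le> rank M X + 1"
proof -
  obtain I where I: "I \<subseteq> insert x X" "indep M I" "card I = rank M (insert x X)"
    by (rule rank_witness)
  have "card (I - {x}) \<le> rank M X"
    using I indep_mono[of I "I - {x}"] by (intro card_le_rank) auto
  moreover have "card I \<le> card (I - {x}) + 1"
    by (simp add: card_Diff_singleton_if) linarith
  ultimately show ?thesis using I by simp
qed

lemma indep_extend_to_rank:
  assumes "indep M I" and "I \<subseteq> X"
  obtains J where "I \<subseteq> J" and "J \<subseteq> X" and "indep M J" and "card J = rank M X"
proof -
  have "\<exists>J. I \<subseteq> J \<and> J \<subseteq> X \<and> indep M J \<and> card J = rank M X"
    using assms
  proof (induction "rank M X - card I" arbitrary: I)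
    case 0
    then show ?case using card_le_rank[of I X] by (intro exI[of _ I]) auto
  next
    case (Suc d)
    obtain K where K: "K \<subseteq> X" "indep M K" "card K = rank M X"
      by (rule rank_witness)
    then have "card I < card K" using Suc.hyps(2) by simp
    then obtain y where y: "y \<in> K - I" "indep M (insert y I)"
      using indep_augment[of I K] Suc.prems(1) K(2) by auto
    have "card (insert y I) = Suc (card I)"
      using y finite_indep[OF Suc.prems(1)] by simp
    then have "\<exists>J. insert y I \<subseteq> J \<and> J \<subseteq> X \<and> indep M J \<and> card J = rank M X"
      using Suc.hyps(2) Suc.prems y K by (intro Suc.hyps(1)) auto
    then show ?case by auto
  qed
  then show ?thesis using that by auto
qed

text \<open>
  The equality of ranks says that \<open>x\<close> lies in the closure. If it failed for the larger set, a
  basis of the larger set extending one of the smaller set could be enlarged by \<open>x\<close>, and then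
  so could the latter.
\<close>

lemma rank_insert_eq_superset:
  assumes eq: "rank M (insert x X) = rank M X" and sub: "X \<subseteq> Y"
  shows "rank M (insert x Y) = rank M Y"
proof (rule ccontr)
  assume "rank M (insert x Y) \<noteq> rank M Y"
  then have gt: "rank M Y < rank M (insert x Y)"
    using rank_mono[OF subset_insertI, of Y x] by simp
  obtain I where I: "I \<subseteq> X" "indep M I" "card I = rank M X"
    by (rule rank_witness)
  obtain J where J: "I \<subseteq> J" "J \<subseteq> Y" "indep M J" "card J = rank M Y"
    using indep_extend_to_rank[of I Y] I sub by auto
  obtain K where K: "J \<subseteq> K" "K \<subseteq> insert x Y" "indep M K" "card K = rank M (insert x Y)"
    using indep_extend_to_rank[of J "insert x Y"] J by auto
  have "\<not> K \<subseteq> Y"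
    using card_le_rank[of K Y] K gt by auto
  then have "x \<in> K" "x \<notin> Y"
    using K by auto
  have "indep M (insert x I)"
    using indep_mono[OF K(3)] \<open>x \<in> K\<close> K(1) J(1) by simp
  then have "card (insert x I) \<le> rank M (insert x X)"
    using I by (intro card_le_rank) auto
  moreover have "x \<notin> I"
    using I sub \<open>x \<notin> Y\<close> by auto
  ultimately show False
    using eq I finite_indep by simp
qed

lemma circuit_rank_insert:
  assumes C: "circuit M C" and c: "c \<in> C" and sub: "C - {c} \<subseteq> X"
  shows "rank M (insert c X) = rank M X"
proof (rule rank_insert_eq_superset[OF _ sub])
  have dep: "\<not> indep M C" and "indep M (C - {c})" and fin: "finite C"
    using C c finite_ground finite_subset unfolding circuit_def by auto
  then have *: "rank M (C - {c}) = card C - 1"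
    using c rank_indep by (simp add: card_Diff_singleton)
  obtain I where I: "I \<subseteq> C" "indep M I" "card I = rank M C"
    by (rule rank_witness)
  then have "I \<subset> C" using dep by auto
  then have "card I < card C" using fin by (simp add: psubset_card_mono)
  then have "rank M C \<le> rank M (C - {c})" using I * by simp
  then show "rank M (insert c (C - {c})) = rank M (C - {c})"
    using rank_mono[of "C - {c}" C] c by (simp add: insert_absorb)
qed

lemma basis_iff_card: "basis M B \<longleftrightarrow> indep M B \<and> card B = rank M (ground M)"
proof
  assume B: "basis M B"
  then have ind: "indep M B" unfolding basis_def by simp
  obtain J where J: "B \<subseteq> J" "indep M J" "card J = rank M (ground M)"
    using indep_extend_to_rank[OF ind indep_subset_ground[OF ind]] .
  then have "J = B"
    using B unfolding basis_def by blast
  then show "indep M B \<and> card B = rank M (ground M)"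
    using J by simp
next
  assume B: "indep M B \<and> card B = rank M (ground M)"
  show "basis M B"
    unfolding basis_def
  proof (intro conjI allI impI)
    fix X assume X: "indep M X \<and> B \<subseteq> X"
    then have "card X \<le> card B"
      using B card_le_rank[of X "ground M"] indep_subset_ground[of X] by simp
    then show "X = B"
      using X card_seteq[of X B] finite_indep[of X] by simp
  qed (use B in simp)
qed

lemma cocircuit_meets_basis:
  assumes S: "cocircuit M S" and B: "basis M B"
  shows "B \<inter> S \<noteq> {}"
proof
  assume "B \<inter> S = {}"
  moreover have "S \<subseteq> ground M" "\<not> indep (dual M) S"
    using S unfolding cocircuit_def circuit_def by (simp_all add: dual_def)
  ultimately show False using B unfolding dual_def by auto
qed

text \<open>
  Minimality of a cocircuit yields a basis meeting it in the single prescribed element; this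
  basis witnesses that the complement of a cocircuit is a hyperplane.
\<close>

lemma cocircuit_basis:
  assumes S: "cocircuit M S" and x: "x \<in> S"
  obtains B where "basis M B" and "B \<inter> S = {x}"
proof -
  have "S - {x} \<subset> S" using x by auto
  then have "indep (dual M) (S - {x})"
    using S unfolding cocircuit_def circuit_def by blast
  then obtain B where B: "basis M B" "B \<inter> (S - {x}) = {}"
    unfolding dual_def by auto
  have "B \<inter> S \<noteq> {}"
    using cocircuit_meets_basis[OF S B(1)] .
  then show ?thesis using B that by auto
qed

lemma rank_ground_le_cocircuit_complement:
  assumes S: "cocircuit M S" and x: "x \<in> S"
  shows "rank M (ground M) \<le> rank M (ground M - S) + 1"
proof -
  obtain B where B: "basis M B" "B \<inter> S = {x}"
    using cocircuit_basis[OF S x] .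
  have ind: "indep M B" and card: "card B = rank M (ground M)"
    using B(1) basis_iff_card by auto
  have "card (B - {x}) \<le> rank M (ground M - S)"
  proof (rule card_le_rank)
    show "indep M (B - {x})" by (rule indep_mono[OF ind]) auto
    show "B - {x} \<subseteq> ground M - S" using indep_subset_ground[OF ind] B(2) by blast
  qed
  moreover have "card (B - {x}) = card B - 1"
    using B(2) by (intro card_Diff_singleton) auto
  ultimately show ?thesis using card by simp
qed

text \<open>
  If \<open>x\<close> were spanned by a set avoiding the cocircuit, it would be spanned by the complement of
  the cocircuit. The basis meeting the cocircuit only in \<open>x\<close> would then force that complement to
  have full rank, hence to contain a basis missing the cocircuit.
\<close>

lemma cocircuit_rank_insert:
  assumes S: "cocircuit M S" and x: "x \<in> S" and X: "X \<subseteq> ground M" "X \<inter> S = {}"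
  shows "rank M (insert x X) = rank M X + 1"
proof (rule ccontr)
  assume "rank M (insert x X) \<noteq> rank M X + 1"
  then have "rank M (insert x X) = rank M X"
    using rank_insert_le[of x X] rank_mono[OF subset_insertI, of X x] by simp
  then have eq: "rank M (insert x (ground M - S)) = rank M (ground M - S)"
    by (rule rank_insert_eq_superset) (use X in auto)
  obtain B where B: "basis M B" "B \<inter> S = {x}"
    using cocircuit_basis[OF S x] .
  have ind: "indep M B" and card: "card B = rank M (ground M)"
    using B(1) basis_iff_card by auto
  have "card B \<le> rank M (insert x (ground M - S))"
  proof (rule card_le_rank[OF ind])
    show "B \<subseteq> insert x (ground M - S)" using indep_subset_ground[OF ind] B(2) by blast
  qed
  then have le: "rank M (ground M) \<le> rank M (ground M - S)"
    using card eq by simp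
  obtain I where I: "I \<subseteq> ground M - S" "indep M I" "card I = rank M (ground M - S)"
    by (rule rank_witness)
  then have "basis M I"
    using le rank_mono[of "ground M - S" "ground M"] unfolding basis_iff_card by simp
  moreover have "I \<inter> S = {}" using I by auto
  ultimately show False
    using cocircuit_meets_basis[OF S] by simp
qed

end

section \<open>Ranks of runs of consecutive pairs\<close>

text \<open>
  The ordering is unrolled to a sequence \<open>e\<close> on all natural numbers in which every window of
  length \<open>2 * N\<close> enumerates the ground set, so that a run may wrap around without a case
  distinction. Writing the two lengths as \<open>2 * N\<close> and \<open>2 * s\<close> counts the pairs
  \<open>{e a, e (a + 1)}\<close> with \<open>a\<close> odd, which are the units of the argument.
\<close>

locale even_circuit_cocircuit_sequence = matroid M for M :: "'a matroid_struct" +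
  fixes e :: "nat \<Rightarrow> 'a" and N s :: nat
  assumes s_pos: "0 < s"
    and s_less: "s < N"
    and inj_window: "inj_on e {a..<a + 2 * N}"
    and image_window: "e ` {a..<a + 2 * N} = ground M"
    and circuit_run: "odd a \<Longrightarrow> circuit M (e ` {a..<a + 2 * s})"
    and cocircuit_run: "odd a \<Longrightarrow> cocircuit M (e ` {a..<a + 2 * s})"
begin

lemma run_subset_ground: "e ` A \<subseteq> ground M"
proof
  fix x assume "x \<in> e ` A"
  then obtain i where "x = e i" by auto
  moreover have "i \<in> {i..<i + 2 * N}" using s_less by simp
  ultimately show "x \<in> ground M" using image_window[of i] by blast
qed

lemma ground_Diff_run:
  assumes "c \<le> 2 * N"
  shows "ground M - e ` {a..<a + c} = e ` {a + c..<a + 2 * N}"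
proof -
  have "e ` ({a..<a + 2 * N} - {a..<a + c}) = ground M - e ` {a..<a + c}"
    using inj_on_image_set_diff[OF inj_window[of a], of "{a..<a + 2 * N}" "{a..<a + c}"]
      image_window[of a] assms by simp
  moreover have "{a..<a + 2 * N} - {a..<a + c} = {a + c..<a + 2 * N}"
    using assms by auto
  ultimately show ?thesis by simp
qed

text \<open>
  Once a run contains \<open>s - 1\<close> pairs, the next pair completes a circuit with the last
  \<open>s - 1\<close> of them, so its second element comes for free.
\<close>

lemma rank_run_le:
  assumes "odd a" and "s - 1 \<le> k"
  shows "rank M (e ` {a..<a + 2 * k}) \<le> s - 1 + k"
  using assms(2)
proof (induction k rule: dec_induct)
  case base
  have "card (e ` {a..<a + 2 * (s - 1)}) \<le> 2 * (s - 1)"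
    using card_image_le[of "{a..<a + 2 * (s - 1)}" e] by simp
  then show ?case
    using rank_le_card[of "e ` {a..<a + 2 * (s - 1)}"] by simp
next
  case (step k)
  define b where "b = a + 2 * k"
  define R where "R = e ` {a..<b}"
  define C where "C = e ` {b + 2 - 2 * s..<b + 2 - 2 * s + 2 * s}"
  have le: "2 * s \<le> b + 2" "a \<le> b + 2 - 2 * s"
    using step.hyps unfolding b_def by auto
  have "odd (b + 2 - 2 * s)"
    using assms(1) le(1) unfolding b_def by auto
  then have C: "circuit M C"
    unfolding C_def by (rule circuit_run)
  have split: "{a..<b + 2} = insert (b + 1) (insert b {a..<b})"
    unfolding b_def by auto
  have "e (b + 1) \<in> C"
    unfolding C_def using le(1) s_pos by (intro imageI) auto
  moreover have "C \<subseteq> e ` {a..<b + 2}"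
    unfolding C_def using le by (intro image_mono) auto
  then have "C - {e (b + 1)} \<subseteq> insert (e b) R"
    unfolding R_def split by auto
  ultimately have "rank M (insert (e (b + 1)) (insert (e b) R)) = rank M (insert (e b) R)"
    by (rule circuit_rank_insert[OF C])
  also have "\<dots> \<le> rank M R + 1"
    by (rule rank_insert_le)
  also have "\<dots> \<le> s - 1 + Suc k"
    using step.IH unfolding R_def b_def by simp
  also have "insert (e (b + 1)) (insert (e b) R) = e ` {a..<a + 2 * Suc k}"
    using split unfolding R_def b_def by simp
  finally show ?case .
qed

text \<open>
  As long as \<open>s\<close> pairs lie outside a run, the first \<open>s\<close> of them form a cocircuit disjoint from
  it, so the next element is outside the closure of the run.
\<close>

lemma rank_run_ge:
  assumes "odd a" and "s - 1 \<le> k" and "k + (s - 1) \<le> N"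
  shows "s - 1 + k \<le> rank M (e ` {a..<a + 2 * k})"
  using assms(2,3)
proof (induction k rule: dec_induct)
  case base
  have "inj_on e {a..<a + 2 * s}"
    by (rule inj_on_subset[OF inj_window[of a]]) (use s_less in auto)
  then have "e ` {a..<a + 2 * (s - 1)} \<subset> e ` {a..<a + 2 * s}"
    using s_pos by (intro image_strict_mono) auto
  then have ind: "indep M (e ` {a..<a + 2 * (s - 1)})"
    using circuit_run[OF assms(1)] unfolding circuit_def by auto
  have "card (e ` {a..<a + 2 * (s - 1)}) = 2 * (s - 1)"
    using s_less by (subst card_image[OF inj_on_subset[OF inj_window[of a]]]) auto
  then show ?case using rank_indep[OF ind] by simp
next
  case (step k)
  define b where "b = a + 2 * k"
  define R where "R = e ` {a..<b}"
  define S where "S = e ` {b..<b + 2 * s}"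
  have "odd b" using assms(1) unfolding b_def by simp
  then have S: "cocircuit M S"
    unfolding S_def by (rule cocircuit_run)
  have "b + 2 * s \<le> a + 2 * N"
    using step.prems s_pos unfolding b_def by simp
  then have "R \<inter> S = e ` ({a..<b} \<inter> {b..<b + 2 * s})"
    unfolding R_def S_def b_def
    by (intro inj_on_image_Int[OF inj_window[of a], symmetric]) auto
  then have disj: "R \<inter> S = {}" by auto
  have "e b \<in> S" unfolding S_def using s_pos by auto
  then have "rank M (insert (e b) R) = rank M R + 1"
    using cocircuit_rank_insert[OF S _ _ disj] run_subset_ground R_def by auto
  moreover have "insert (e b) R \<subseteq> e ` {a..<a + 2 * Suc k}"
    unfolding R_def b_def by auto
  ultimately have "rank M R + 1 \<le> rank M (e ` {a..<a + 2 * Suc k})"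
    using rank_mono by metis
  moreover have "s - 1 + k \<le> rank M R"
    using step.IH step.prems unfolding R_def b_def by simp
  ultimately show ?case by simp
qed

lemma rank_run:
  assumes "odd a" and "s - 1 \<le> k" and "k + (s - 1) \<le> N"
  shows "rank M (e ` {a..<a + 2 * k}) = s - 1 + k"
  using rank_run_le rank_run_ge assms by (simp add: le_antisym)

text \<open>
  A run of \<open>N - (s - 1)\<close> pairs already has rank \<open>N\<close>. Conversely the complement of a cocircuit
  is a run of \<open>N - s\<close> pairs and a hyperplane, of rank at most \<open>N - 1\<close> by the bound for runs.
  That bound needs \<open>s - 1 \<le> N - s\<close>; the only other possibility under the hypothesis is
  \<open>N = 2 * (s - 1)\<close>, where a hyperplane with \<open>2 * (s - 2)\<close> elements is too small.
\<close>

lemma rank_ground: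
  assumes "2 * (s - 1) \<le> N"
  shows "rank M (ground M) = N"
proof (rule antisym)
  have "s - 1 + (N - (s - 1)) = rank M (e ` {1..<1 + 2 * (N - (s - 1))})"
    using assms s_less by (intro rank_run[symmetric]) auto
  also have "\<dots> \<le> rank M (ground M)"
    by (rule rank_mono[OF run_subset_ground])
  finally show ge: "N \<le> rank M (ground M)"
    using s_less by simp
  define S where "S = e ` {1..<1 + 2 * s}"
  have "cocircuit M S"
    unfolding S_def by (rule cocircuit_run) simp
  moreover have "e 1 \<in> S"
    unfolding S_def using s_pos by auto
  ultimately have le: "rank M (ground M) \<le> rank M (ground M - S) + 1"
    by (rule rank_ground_le_cocircuit_complement)
  have "ground M - S = e ` {1 + 2 * s..<1 + 2 * N}"
    unfolding S_def using s_less by (intro ground_Diff_run) auto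
  also have "1 + 2 * N = 1 + 2 * s + 2 * (N - s)"
    using s_less by simp
  finally have compl: "ground M - S = e ` {1 + 2 * s..<1 + 2 * s + 2 * (N - s)}" .
  show "rank M (ground M) \<le> N"
  proof (cases "s - 1 \<le> N - s")
    case True
    then have "rank M (ground M - S) \<le> s - 1 + (N - s)"
      unfolding compl by (intro rank_run_le) auto
    then show ?thesis using le s_pos s_less by simp
  next
    case False
    have "rank M (ground M - S) \<le> card (ground M - S)"
      by (rule rank_le_card) (simp add: finite_ground)
    also have "\<dots> \<le> 2 * (N - s)"
      unfolding compl using card_image_le[of "{1 + 2 * s..<1 + 2 * s + 2 * (N - s)}" e] by simp
    finally show ?thesis using le ge False assms s_less by linarith
  qed
qed

lemma connectivity_run:
  assumes "odd a" and "s - 1 \<le> k" and "k + (s - 1) \<le> N"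
  shows "connectivity M (e ` {a..<a + 2 * k}) = 2 * int (s - 1)"
proof -
  have "ground M - e ` {a..<a + 2 * k} = e ` {a + 2 * k..<a + 2 * N}"
    using assms(3) by (intro ground_Diff_run) auto
  also have "a + 2 * N = a + 2 * k + 2 * (N - k)"
    using assms(3) by simp
  finally have "ground M - e ` {a..<a + 2 * k}
      = e ` {a + 2 * k..<a + 2 * k + 2 * (N - k)}" .
  then have "rank M (ground M - e ` {a..<a + 2 * k}) = s - 1 + (N - k)"
    using assms by (simp only:) (intro rank_run; simp)
  then show ?thesis
    unfolding connectivity_def using rank_run[OF assms] rank_ground assms by simp
qed

lemma local_connectivity_adjacent_runs:
  assumes "odd a" and "s - 1 \<le> k" and "s - 1 \<le> l" and "k + l + (s - 1) \<le> N"
  shows "local_connectivity M (e ` {a..<a + 2 * k}) (e ` {a + 2 * k..<a + 2 * k + 2 * l})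
    = int (s - 1)"
proof -
  have "{a..<a + 2 * k} \<union> {a + 2 * k..<a + 2 * k + 2 * l} = {a..<a + 2 * (k + l)}"
    by auto
  then have un: "e ` {a..<a + 2 * k} \<union> e ` {a + 2 * k..<a + 2 * k + 2 * l}
      = e ` {a..<a + 2 * (k + l)}"
    by (metis image_Un)
  have "rank M (e ` {a..<a + 2 * k}) = s - 1 + k"
    "rank M (e ` {a + 2 * k..<a + 2 * k + 2 * l}) = s - 1 + l"
    "rank M (e ` {a..<a + 2 * (k + l)}) = s - 1 + (k + l)"
    using assms by (intro rank_run; simp)+
  then show ?thesis
    unfolding local_connectivity_def un by simp
qed

end

section \<open>Cyclic subscripts and concatenations\<close>

lemma cyc_add_length:
  assumes "xs \<noteq> []"
  shows "cyc xs (i + length xs) = cyc xs i"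
proof -
  have "i + length xs + length xs - 1 = (i + length xs - 1) + length xs"
    using assms by (cases xs) auto
  then show ?thesis unfolding cyc_def by simp
qed

lemma cyc_mod_add:
  assumes "xs \<noteq> []"
  shows "cyc xs (i mod length xs + j) = cyc xs (i + j)"
proof -
  have "(i mod length xs + j + length xs - 1) = i mod length xs + (j + length xs - 1)"
    "(i + j + length xs - 1) = i + (j + length xs - 1)"
    using assms by (cases xs; simp)+
  then show ?thesis unfolding cyc_def by (simp add: mod_add_left_eq)
qed

lemma cyc_Suc: "xs \<noteq> [] \<Longrightarrow> cyc xs (Suc q) = xs ! (q mod length xs)"
  unfolding cyc_def by simp

lemma cyc_in_set: "xs \<noteq> [] \<Longrightarrow> cyc xs i \<in> set xs"
  unfolding cyc_def by simp

lemma inj_on_cyc_window: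
  assumes "distinct xs"
  shows "inj_on (cyc xs) {a..<a + length xs}"
proof -
  have "i = j" if "i \<le> j" "j < i + length xs" "cyc xs i = cyc xs j" for i j
  proof -
    have len: "0 < length xs" using that by linarith
    have "(i + length xs - 1) mod length xs = (j + length xs - 1) mod length xs"
      using that(3) assms len unfolding cyc_def by (simp add: nth_eq_iff_index_eq)
    then have "length xs dvd (j + length xs - 1) - (i + length xs - 1)"
      using that(1) by (metis mod_eq_dvd_iff_nat add_le_mono1 diff_le_mono)
    moreover have "(j + length xs - 1) - (i + length xs - 1) = j - i"
      using len by simp
    ultimately have "length xs dvd j - i" by simp
    then show ?thesis using that by (auto dest: dvd_imp_le)
  qed
  note wlog = this
  show ?thesis
  proof (rule inj_onI)
    fix i j
    assume "i \<in> {a..<a + length xs}" "j \<in> {a..<a + length xs}" "cyc xs i = cyc xs j"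
    then show "i = j"
      using wlog[of i j] wlog[of j i] by (cases "i \<le> j") auto
  qed
qed

lemma cyc_image_window:
  assumes "distinct xs" and "xs \<noteq> []"
  shows "cyc xs ` {a..<a + length xs} = set xs"
proof (rule card_subset_eq)
  show "card (cyc xs ` {a..<a + length xs}) = card (set xs)"
    using card_image[OF inj_on_cyc_window[OF assms(1), of a]] distinct_card[OF assms(1)] by simp
qed (use cyc_in_set[OF assms(2)] in auto)

text \<open>
  Reduction modulo an even length preserves parity, so the condition imposed on odd subscripts
  in a single round holds for all odd subscripts of the periodic sequence.
\<close>

lemma even_cyclic_orderingD_odd:
  assumes ord: "even_cyclic_ordering t M \<sigma>" and n: "even (length \<sigma>)" and a: "odd a"
  shows "circuit M (cyc \<sigma> ` {a..<a + t})" and "cocircuit M (cyc \<sigma> ` {a..<a + t})"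
proof -
  have \<sigma>: "\<sigma> \<noteq> []" and t: "0 < t"
    using ord unfolding even_cyclic_ordering_def by auto
  define i where "i = a mod length \<sigma>"
  have "odd i"
    unfolding i_def using a n by (simp add: dvd_mod_iff)
  moreover have "i < length \<sigma>"
    unfolding i_def using \<sigma> by simp
  ultimately have i: "i \<in> {1..length \<sigma>}" "odd i"
    by (auto intro: Suc_leI odd_pos)
  have shift: "cyc \<sigma> ` {b..<b + t} = (\<lambda>j. cyc \<sigma> (b + j)) ` {0..<t}" for b
    using image_image[of "cyc \<sigma>" "\<lambda>j. b + j" "{0..<t}"] image_add_atLeastLessThan[of b 0 t]
    by (simp add: add.commute)
  have "{i..i + t - 1} = {i..<i + t}"
    using t by auto
  moreover have "cyc \<sigma> ` {i..<i + t} = cyc \<sigma> ` {a..<a + t}"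
    unfolding shift i_def using cyc_mod_add[OF \<sigma>] by simp
  ultimately show "circuit M (cyc \<sigma> ` {a..<a + t})" "cocircuit M (cyc \<sigma> ` {a..<a + t})"
    using ord i unfolding even_cyclic_ordering_def Let_def by auto
qed

text \<open>
  The lift of the cyclic sequence of starting subscripts to a strictly increasing sequence:
  going once around \<open>\<kappa>\<close> adds \<open>n\<close>. Every block, including the one that wraps around, is then
  the image of an interval between consecutive values.
\<close>

definition unrolled :: "nat \<Rightarrow> nat list \<Rightarrow> nat \<Rightarrow> nat" where
  "unrolled n \<kappa> q = (q div length \<kappa>) * n + \<kappa> ! (q mod length \<kappa>)"

lemma unrolled_add_length:
  "\<kappa> \<noteq> [] \<Longrightarrow> unrolled n \<kappa> (q + length \<kappa>) = unrolled n \<kappa> q + n"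
  unfolding unrolled_def by simp

lemma unrolled_Suc_cases:
  assumes "\<kappa> \<noteq> []"
  obtains (step) "Suc (q mod length \<kappa>) < length \<kappa>"
      "Suc q mod length \<kappa> = Suc (q mod length \<kappa>)" "Suc q div length \<kappa> = q div length \<kappa>"
  | (wrap) "Suc (q mod length \<kappa>) = length \<kappa>"
      "Suc q mod length \<kappa> = 0" "Suc q div length \<kappa> = Suc (q div length \<kappa>)"
proof (cases "Suc (q mod length \<kappa>) = length \<kappa>")
  case True
  then show ?thesis using wrap by (auto simp: mod_Suc div_Suc)
next
  case False
  moreover have "q mod length \<kappa> < length \<kappa>" using assms by simp
  ultimately show ?thesis using step by (auto simp: mod_Suc div_Suc)
qed

lemma unrolled_less_Suc:
  assumes "\<kappa> \<noteq> []" and "set \<kappa> \<subseteq> {1..n}" and "sorted_wrt (<) \<kappa>"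
  shows "unrolled n \<kappa> q < unrolled n \<kappa> (Suc q)"
  using assms(1)
proof (cases rule: unrolled_Suc_cases[where q = q])
  case step
  then have "\<kappa> ! (q mod length \<kappa>) < \<kappa> ! Suc (q mod length \<kappa>)"
    using assms(3) by (intro sorted_wrt_nth_less) auto
  then show ?thesis using step by (simp add: unrolled_def)
next
  case wrap
  have "\<kappa> ! (q mod length \<kappa>) \<in> set \<kappa>" "\<kappa> ! 0 \<in> set \<kappa>"
    using assms(1) by auto
  then have "\<kappa> ! (q mod length \<kappa>) \<le> n" "0 < \<kappa> ! 0"
    using assms(2) by (force simp: subset_iff)+
  then show ?thesis using wrap by (simp add: unrolled_def)
qed

text \<open>
  The offset 2 arises because \<open>unrolled\<close> counts from 0 while \<open>cyc\<close> counts from 1, and because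
  the block with subscript \<open>i\<close> starts at the index with subscript \<open>i - 1\<close>.
\<close>

lemma concatenation_block:
  assumes conc: "concatenation \<sigma> \<kappa> \<Phi>" and \<sigma>: "\<sigma> \<noteq> []"
  shows "cyc \<Phi> (q + 2) = cyc \<sigma> ` {unrolled (length \<sigma>) \<kappa> q..<unrolled (length \<sigma>) \<kappa> (Suc q)}"
proof -
  let ?m = "length \<kappa>" and ?n = "length \<sigma>"
  have len: "length \<Phi> = ?m" and \<Phi>: "\<Phi> \<noteq> []" and \<kappa>: "\<kappa> \<noteq> []"
    and range: "set \<kappa> \<subseteq> {1..?n}" and sorted: "sorted_wrt (<) \<kappa>"
    using conc unfolding concatenation_def by auto
  have block: "cyc \<Phi> i = cyclic_block \<sigma> (cyc \<kappa> (i - 1)) (cyc \<kappa> i)" if "i \<in> {1..?m}" for i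
    using conc that len unfolding concatenation_def by auto
  define i where "i = Suc (Suc q mod ?m)"
  have "i \<in> {1..?m}"
    unfolding i_def using \<kappa> by (simp add: Suc_leI)
  moreover have "cyc \<Phi> (q + 2) = cyc \<Phi> i"
    unfolding i_def using cyc_Suc[OF \<Phi>] len by (simp add: mod_Suc_eq)
  moreover have "cyc \<kappa> i = \<kappa> ! (Suc q mod ?m)"
    unfolding i_def using cyc_Suc[OF \<kappa>] by (simp add: mod_Suc_eq)
  moreover have "cyc \<kappa> (i - 1) = \<kappa> ! (q mod ?m)"
    using cyc_mod_add[OF \<kappa>, of "Suc q" 0] cyc_Suc[OF \<kappa>, of q] unfolding i_def by simp
  ultimately have eq: "cyc \<Phi> (q + 2)
      = cyclic_block \<sigma> (\<kappa> ! (q mod ?m)) (\<kappa> ! (Suc q mod ?m))"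
    using block[of i] by simp
  have periodic: "cyc \<sigma> (j + d * ?n) = cyc \<sigma> j" for j d
  proof (induction d)
    case (Suc d)
    then show ?case
      using cyc_add_length[OF \<sigma>, of "j + d * ?n"] by (simp add: ac_simps)
  qed simp
  have shift: "cyc \<sigma> ` {d * ?n + x..<d * ?n + y} = cyc \<sigma> ` {x..<y}" for x y d
    using image_image[of "cyc \<sigma>" "\<lambda>j. j + d * ?n" "{x..<y}"] periodic
    by (simp add: add.commute)
  show ?thesis
    using \<kappa>
  proof (cases rule: unrolled_Suc_cases[where q = q])
    case step
    then have "\<kappa> ! (q mod ?m) < \<kappa> ! Suc (q mod ?m)"
      using sorted by (intro sorted_wrt_nth_less) auto
    then show ?thesis
      using step unfolding eq cyclic_block_def unrolled_def by (simp add: shift)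
  next
    case wrap
    have "\<kappa> ! 0 \<le> \<kappa> ! (q mod ?m)"
    proof (cases "q mod ?m = 0")
      case False
      then show ?thesis
        using sorted_wrt_nth_less[OF sorted, of 0 "q mod ?m"] wrap(1) by simp
    qed simp
    then have "cyc \<Phi> (q + 2) = cyc \<sigma> ` {\<kappa> ! (q mod ?m)..<\<kappa> ! 0 + ?n}"
      unfolding eq cyclic_block_def using wrap(2) by simp
    moreover have "unrolled ?n \<kappa> (Suc q) = (q div ?m) * ?n + (\<kappa> ! 0 + ?n)"
      unfolding unrolled_def wrap(2,3) by simp
    ultimately show ?thesis
      using shift[of "q div ?m" "\<kappa> ! (q mod ?m)" "\<kappa> ! 0 + ?n"] unrolled_def[of ?n \<kappa> q] by simp
  qed
qed

lemma ex_shifted_index: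
  fixes i m :: nat
  assumes "i \<in> {1..m}"
  obtains q where "i = q + 2 \<or> i + m = q + 2"
proof (cases "i = 1")
  case True
  then show ?thesis using that[of "m - 1"] assms by auto
next
  case False
  then have "i = (i - 2) + 2" using assms unfolding atLeastAtMost_iff by linarith
  then show ?thesis using that[of "i - 2"] by blast
qed

section \<open>Concatenations into long even blocks are flowers\<close>

theorem theorem1p3:
  fixes M :: "'a matroid_struct" and t :: nat
    and \<sigma> :: "'a list" and \<kappa> :: "nat list" and \<Phi> :: "'a set list"
  assumes "0 < t" and "even t"
    and "matroid M"
    and "even_cyclic_ordering t M \<sigma>"
    and "concatenation \<sigma> \<kappa> \<Phi>"
    and "\<forall>i\<in>{1..length \<Phi>}. \<forall>j. cyc \<kappa> (i - 1) = j + 1 \<longrightarrow>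
           t - 2 \<le> card (cyc \<Phi> i) \<and> even (card (cyc \<Phi> i)) \<and> odd (j + 1)"
  shows "flower M (t - 1) \<Phi> \<and>
    (3 \<le> length \<Phi> \<longrightarrow>
      (\<forall>i\<in>{1..length \<Phi>}.
        real_of_int (local_connectivity M (cyc \<Phi> i) (cyc \<Phi> (i + 1))) = 1 / 2 * (real t - 2)))"
proof -
  define e where "e = cyc \<sigma>"
  define n where "n = length \<sigma>"
  define m where "m = length \<Phi>"
  define g where "g = unrolled n \<kappa>"
  have dist: "distinct \<sigma>" and ground: "set \<sigma> = ground M" and tn: "t + 1 \<le> n"
    using assms(4) unfolding even_cyclic_ordering_def n_def by auto
  have \<sigma>: "\<sigma> \<noteq> []" using tn n_def by auto
  have len\<kappa>: "length \<kappa> = m" and m: "1 \<le> m" and \<kappa>: "\<kappa> \<noteq> []" and \<Phi>: "\<Phi> \<noteq> []"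
    and range: "set \<kappa> \<subseteq> {1..n}" and sorted: "sorted_wrt (<) \<kappa>"
    using assms(5) unfolding concatenation_def m_def n_def by auto
  have inj: "inj_on e {a..<a + n}" and img: "e ` {a..<a + n} = ground M" for a
    using inj_on_cyc_window[OF dist] cyc_image_window[OF dist \<sigma>] ground
    unfolding e_def n_def by auto
  have g_Suc: "g q < g (Suc q)" for q
    unfolding g_def by (rule unrolled_less_Suc[OF \<kappa> range sorted])
  have g_mono: "g p \<le> g q" if "p \<le> q" for p q
    by (rule lift_Suc_mono_le[OF _ that]) (use g_Suc in \<open>auto intro: less_imp_le\<close>)
  have g_m: "g (q + m) = g q + n" for q
    unfolding g_def using unrolled_add_length[OF \<kappa>] len\<kappa> by simp
  have block: "cyc \<Phi> (q + 2) = e ` {g q..<g (Suc q)}" for q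
    unfolding e_def g_def n_def by (rule concatenation_block[OF assms(5) \<sigma>])
  have block_nth: "\<Phi> ! (Suc q mod m) = e ` {g q..<g (Suc q)}" for q
    using block[of q] cyc_Suc[OF \<Phi>, of "Suc q"] unfolding m_def by simp
  have index: "\<exists>q. cyc \<Phi> i = cyc \<Phi> (q + 2) \<and> cyc \<Phi> (i + 1) = cyc \<Phi> (Suc q + 2)"
    if i: "i \<in> {1..m}" for i
  proof -
    obtain q where "i = q + 2 \<or> i + m = q + 2"
      using ex_shifted_index[OF i] .
    then show ?thesis
    proof
      assume "i = q + 2"
      then show ?thesis by (intro exI[of _ q]) simp
    next
      assume "i + m = q + 2"
      then have "q + 2 = i + length \<Phi>" "Suc q + 2 = (i + 1) + length \<Phi>"
        unfolding m_def by auto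
      then show ?thesis using cyc_add_length[OF \<Phi>] by (intro exI[of _ q]) metis
    qed
  qed
  have \<Phi>_nth: "\<exists>q. q < m \<and> \<Phi> ! j = e ` {g q..<g (Suc q)} \<and> j = Suc q mod m"
    if "j < m" for j
  proof (cases j)
    case 0
    then show ?thesis using block_nth[of "m - 1"] m by (intro exI[of _ "m - 1"]) auto
  next
    case (Suc q)
    then show ?thesis using block_nth[of q] that by (intro exI[of _ q]) auto
  qed
  show ?thesis
  proof (cases "m = 1")
    case True
    have "\<Phi> ! 0 = e ` {g 0..<g 0 + n}"
      using block_nth[of 0] g_m[of 0] True by simp
    then have "\<Phi> = [ground M]"
      using True img unfolding m_def by (cases \<Phi>) auto
    then show ?thesis unfolding flower_def by simp
  next
    case False
    with m have m2: "2 \<le> m" by simp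
    have cardB: "card (e ` {g q..<g (Suc q)}) = g (Suc q) - g q" for q
    proof -
      have "g (Suc q) \<le> g q + n"
        using g_mono[of "Suc q" "q + m"] g_m m by simp
      then show ?thesis
        by (subst card_image[OF inj_on_subset[OF inj[of "g q"]]]) auto
    qed
    have hyp: "t - 2 \<le> g (Suc q) - g q" "even (g (Suc q) - g q)" "odd (\<kappa> ! (q mod m))" for q
    proof -
      define i where "i = Suc (Suc q mod m)"
      have i: "i \<in> {1..m}" unfolding i_def using m by (simp add: Suc_leI)
      have *: "cyc \<kappa> (i - 1) = \<kappa> ! (q mod m)"
        using cyc_mod_add[OF \<kappa>, of "Suc q" 0] cyc_Suc[OF \<kappa>, of q] len\<kappa> unfolding i_def by simp
      have "cyc \<kappa> (i - 1) \<in> {1..n}"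
        using cyc_in_set[OF \<kappa>, of "i - 1"] range by blast
      then have "cyc \<kappa> (i - 1) = (cyc \<kappa> (i - 1) - 1) + 1" by simp
      then have "t - 2 \<le> card (cyc \<Phi> i) \<and> even (card (cyc \<Phi> i)) \<and> odd (cyc \<kappa> (i - 1))"
        using assms(6) i unfolding m_def by metis
      moreover have "cyc \<Phi> i = e ` {g q..<g (Suc q)}"
        using block_nth[of q] cyc_Suc[OF \<Phi>, of "Suc q mod m"] m unfolding i_def m_def
        by (simp add: mod_Suc_eq)
      ultimately show "t - 2 \<le> g (Suc q) - g q" "even (g (Suc q) - g q)" "odd (\<kappa> ! (q mod m))"
        using cardB[of q] * by auto
    qed
    have par: "even (g (Suc q)) \<longleftrightarrow> even (g q)" for q
      using hyp(2)[of q] g_Suc[of q] by (simp add: less_imp_le)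
    have odd_g: "odd (g q)" for q
    proof (induction q)
      case 0
      then show ?case using hyp(3)[of 0] unfolding g_def unrolled_def by simp
    next
      case (Suc q)
      then show ?case using par by simp
    qed
    \<comment> \<open>Positions 0 and \<open>m\<close> are one full round apart, and both start at odd subscripts.\<close>
    have even_n: "even n"
      using odd_g[of m] odd_g[of 0] g_m[of 0] by simp
    define N where "N = n div 2"
    define s where "s = t div 2"
    have nN: "n = 2 * N" and ts: "t = 2 * s"
      unfolding N_def s_def using even_n assms(2) by auto
    interpret matroid M by (rule assms(3))
    interpret even_circuit_cocircuit_sequence M e N s
    proof
      show "0 < s" "s < N" using assms(1) tn nN ts by auto
      show "inj_on e {a..<a + 2 * N}" "e ` {a..<a + 2 * N} = ground M" for a
        using inj img nN by auto
      show "circuit M (e ` {a..<a + 2 * s})" "cocircuit M (e ` {a..<a + 2 * s})"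
        if "odd a" for a
        using even_cyclic_orderingD_odd[OF assms(4) _ that] even_n ts unfolding e_def n_def
        by auto
    qed
    define k where "k q = (g (Suc q) - g q) div 2" for q
    have gk: "g (Suc q) = g q + 2 * k q" for q
      unfolding k_def using hyp(2)[of q] g_Suc[of q] by simp
    have k_ge: "s - 1 \<le> k q" for q
      using hyp(1)[of q] gk[of q] ts by simp
    \<comment> \<open>With \<open>m \<ge> 2\<close>, the following block lies in the complement and provides the room there.\<close>
    have sep_block: "exactly_separating M (t - 1) (e ` {g q..<g (Suc q)})" for q
    proof -
      have "g (Suc (Suc q)) \<le> g q + n"
        using g_mono[of "Suc (Suc q)" "q + m"] g_m m2 by simp
      then have "k q + k (Suc q) \<le> N"
        using gk nN by simp
      then have "k q + (s - 1) \<le> N"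
        using k_ge[of "Suc q"] by simp
      then show ?thesis
        unfolding exactly_separating_def gk
        using connectivity_run[OF odd_g k_ge] ts s_pos by simp
    qed
    \<comment> \<open>With \<open>m \<ge> 3\<close>, a third block lies outside the union of two adjacent ones.\<close>
    have room: "k q + k (Suc q) + (s - 1) \<le> N" if "3 \<le> m" for q
    proof -
      have "g (Suc (Suc (Suc q))) \<le> g q + n"
        using g_mono[of "Suc (Suc (Suc q))" "q + m"] g_m that by simp
      then have "k q + k (Suc q) + k (Suc (Suc q)) \<le> N"
        using gk nN by simp
      then show ?thesis using k_ge[of "Suc (Suc q)"] by simp
    qed
    have sep_union: "exactly_separating M (t - 1)
        (e ` {g q..<g (Suc q)} \<union> e ` {g (Suc q)..<g (Suc (Suc q))})" if "3 \<le> m" for q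
    proof -
      have "{g q..<g (Suc q)} \<union> {g (Suc q)..<g (Suc (Suc q))} = {g q..<g q + 2 * (k q + k (Suc q))}"
        using gk[of q] gk[of "Suc q"] by auto
      then have un: "e ` {g q..<g (Suc q)} \<union> e ` {g (Suc q)..<g (Suc (Suc q))}
          = e ` {g q..<g q + 2 * (k q + k (Suc q))}"
        by (metis image_Un)
      show ?thesis
        unfolding exactly_separating_def un
        using connectivity_run[OF odd_g _ room[OF that, of q]] k_ge[of q] ts s_pos by simp
    qed
    have local: "local_connectivity M (e ` {g q..<g (Suc q)})
        (e ` {g (Suc q)..<g (Suc (Suc q))}) = int (s - 1)" if "3 \<le> m" for q
      using local_connectivity_adjacent_runs[OF odd_g k_ge k_ge room[OF that, of q]]
      unfolding gk .
    have disj: "e ` {g p..<g (Suc p)} \<inter> e ` {g q..<g (Suc q)} = {}"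
      if "p < q" "q < p + m" for p q
    proof -
      have le: "g (Suc p) \<le> g q" "g (Suc q) \<le> g p + n" "g p \<le> g q"
        using g_mono[of "Suc p" q] g_mono[of "Suc q" "p + m"] g_mono[of p q] g_m that by auto
      have "e ` {g p..<g (Suc p)} \<inter> e ` {g q..<g (Suc q)}
          = e ` ({g p..<g (Suc p)} \<inter> {g q..<g (Suc q)})"
        using le g_Suc[of q]
        by (intro inj_on_image_Int[OF inj[of "g p"], symmetric]) auto
      also have "{g p..<g (Suc p)} \<inter> {g q..<g (Suc q)} = {}"
        using le by auto
      finally show ?thesis by simp
    qed
    have nonempty: "e ` {g q..<g (Suc q)} \<noteq> {}" for q
      using g_Suc[of q] by auto
    have disj_nth: "\<Phi> ! i \<inter> \<Phi> ! j = {}" if ij: "i < m" "j < m" "i \<noteq> j" for i j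
    proof -
      obtain p q where "p < m" "\<Phi> ! i = e ` {g p..<g (Suc p)}" "i = Suc p mod m"
        "q < m" "\<Phi> ! j = e ` {g q..<g (Suc q)}" "j = Suc q mod m"
        using \<Phi>_nth[OF ij(1)] \<Phi>_nth[OF ij(2)] by metis
      then show ?thesis
        using disj[of p q] disj[of q p] ij(3) by (cases p q rule: linorder_cases) auto
    qed
    have nonempty_nth: "\<Phi> ! i \<noteq> {}" if "i < m" for i
      using \<Phi>_nth[OF that] nonempty by metis
    have distinct: "distinct \<Phi>"
      unfolding distinct_conv_nth using disj_nth nonempty_nth m_def by (metis inf.idem)
    have Un: "(\<Union>q<j. {g q..<g (Suc q)}) = {g 0..<g j}" for j
    proof (induction j)
      case (Suc j)
      have "{g 0..<g (Suc j)} = {g 0..<g j} \<union> {g j..<g (Suc j)}"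
        using g_mono[of 0 j] g_Suc[of j] by (intro ivl_disj_un_two(3)[symmetric]) auto
      then show ?case using Suc by (simp add: lessThan_Suc Un_commute)
    qed simp
    have set\<Phi>: "set \<Phi> = (\<lambda>q. e ` {g q..<g (Suc q)}) ` {..<m}"
    proof -
      have "\<Phi> ! j \<in> (\<lambda>q. e ` {g q..<g (Suc q)}) ` {..<m}" if "j < m" for j
        using \<Phi>_nth[OF that] by auto
      moreover have "e ` {g q..<g (Suc q)} \<in> set \<Phi>" for q
      proof -
        have "\<Phi> ! (Suc q mod m) \<in> set \<Phi>"
          using \<Phi> unfolding m_def by simp
        then show ?thesis using block_nth[of q] by simp
      qed
      ultimately show ?thesis
        by (auto simp: in_set_conv_nth m_def[symmetric])
    qed
    have union: "\<Union> (set \<Phi>) = ground M"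
      using Un[of m] g_m[of 0] img[of "g 0"] unfolding set\<Phi> by (simp add: image_UN[symmetric])
    have "partition_on (ground M) (set \<Phi>)"
      unfolding partition_on_def disjoint_def
    proof (intro conjI ballI impI)
      show "\<Union> (set \<Phi>) = ground M" by (rule union)
      show "p \<inter> p' = {}" if "p \<in> set \<Phi>" "p' \<in> set \<Phi>" "p \<noteq> p'" for p p'
        using that disj_nth m_def by (metis in_set_conv_nth)
      show "{} \<notin> set \<Phi>"
        using nonempty_nth m_def by (metis in_set_conv_nth)
    qed
    moreover have "exactly_separating M (t - 1) (cyc \<Phi> i)" if i: "i \<in> {1..m}" for i
      using index[OF i] sep_block block by metis
    moreover have "exactly_separating M (t - 1) (cyc \<Phi> i \<union> cyc \<Phi> (i + 1))"
      if "3 \<le> m" and i: "i \<in> {1..m}" for i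
      using index[OF i] sep_union[OF that(1)] block by metis
    moreover have "real_of_int (local_connectivity M (cyc \<Phi> i) (cyc \<Phi> (i + 1)))
        = 1 / 2 * (real t - 2)" if "3 \<le> m" and i: "i \<in> {1..m}" for i
    proof -
      have "local_connectivity M (cyc \<Phi> i) (cyc \<Phi> (i + 1)) = int (s - 1)"
        using index[OF i] local[OF that(1)] block by metis
      then show ?thesis using ts s_pos by (simp add: of_nat_diff field_simps)
    qed
    ultimately show ?thesis
      unfolding flower_def using distinct m2 m_def by auto
  qed
qed

end
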